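(* Fix a real number $\alpha>-1$. Let $w$ be a positive integer and let $m_0,m_1,\dots,m_{w-1}$ be positive integers. Then the sequence $$\left\{\prod_{k=0}^{w-1}(n-k)^{m_k}\right\}_{n=0}^{\infty}$$ is an $L^{(\alpha)}$-CZDS, where $L^{(\alpha)}=\{L_n^{(\alpha)}(x)\}_{n=0}^\infty$ is the generalized Laguerre polynomial basis.
   Context: For a non-zero function $f$, $Z_C(f)$ denotes the number of non-real zeros of $f$ in $\mathbb{C}$, counted according to multiplicity; for the identically zero function, $Z_C(0)=0$. Let $B=\{b_k\}_{k=0}^\infty$ be a basis of $\mathbb{R}[x]$. A sequence of real numbers $\{\gamma_k\}_{k=0}^\infty$ is a complex zero decreasing sequence for the basis $B$ (a $B$-CZDS) if the linear operator $L:\mathbb{R}[x]\to\mathbb{R}[x]$ determined by $L(b_k)=\gamma_k b_k$ ($k=0,1,2,\dots$) satisfies $Z_C(L(p))\le Z_C(p)$ for every real polynomial $p$. For real $\alpha>-1$, the generalized Laguerre polynomials are $$L_n^{(\alpha)}(x):=\sum_{k=0}^{n}\binom{n+\alpha}{n-k}\frac{(-x)^k}{k!}\qquad(n=0,1,2,\dots),$$ where $\binom{a}{j}=a(a-1)\cdots(a-j+1)/j!$ for real $a$ and integers $j\ge 0$. *)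

theory Defs
  imports Complex_Main "HOL-Computational_Algebra.Polynomial"
begin

interpretation real_poly: vector_space "smult :: real \<Rightarrow> real poly \<Rightarrow> real poly"
  by unfold_locales (simp_all add: smult_add_left smult_add_right)

interpretation real_poly_pair: vector_space_pair
  "smult :: real \<Rightarrow> real poly \<Rightarrow> real poly" "smult :: real \<Rightarrow> real poly \<Rightarrow> real poly" ..

definition nonreal_zero_count :: "real poly \<Rightarrow> nat" where
  "nonreal_zero_count p =
     (if p = 0 then 0
      else \<Sum>z | poly (map_poly complex_of_real p) z = 0 \<and> z \<notin> \<real>.
             order z (map_poly complex_of_real p))"

text \<open>Injectivity makes \<open>b\<close> linearly independent as a family, not only its range as a set.\<close>

definition is_poly_basis :: "(nat \<Rightarrow> real poly) \<Rightarrow> bool" where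
  "is_poly_basis b \<longleftrightarrow>
     inj b \<and> \<not> real_poly.dependent (range b) \<and> real_poly.span (range b) = UNIV"

definition is_diagonal_operator ::
  "(nat \<Rightarrow> real poly) \<Rightarrow> (nat \<Rightarrow> real) \<Rightarrow> (real poly \<Rightarrow> real poly) \<Rightarrow> bool" where
  "is_diagonal_operator b \<gamma> L \<longleftrightarrow>
     Vector_Spaces.linear smult smult L \<and> (\<forall>k. L (b k) = smult (\<gamma> k) (b k))"

lemma diagonal_operator_unique:
  assumes "is_poly_basis b"
  shows "\<exists>!L. is_diagonal_operator b \<gamma> L"
proof (rule ex_ex1I)
  have inj: "inj b" and indep: "\<not> real_poly.dependent (range b)"
    using assms by (auto simp only: is_poly_basis_def)
  define f where "f = (\<lambda>x. smult (\<gamma> (inv b x)) x)"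
  have "\<exists>L. (\<forall>x\<in>range b. L x = f x) \<and> Vector_Spaces.linear smult smult L"
    using real_poly_pair.linear_independent_extend[OF indep, of f] by (simp only: conj_commute)
  then obtain L where L: "\<forall>x\<in>range b. L x = f x" "Vector_Spaces.linear smult smult L"
    by (elim exE conjE)
  have "L (b k) = smult (\<gamma> k) (b k)" for k
    using bspec[OF L(1) rangeI[of b k]] by (simp only: f_def inv_f_f[OF inj])
  then show "\<exists>L. is_diagonal_operator b \<gamma> L"
    unfolding is_diagonal_operator_def using L(2) by (intro exI[of _ L] conjI allI)
next
  fix L L'
  assume L: "is_diagonal_operator b \<gamma> L" and L': "is_diagonal_operator b \<gamma> L'"
  show "L = L'"
  proof
    fix p
    have "p \<in> real_poly.span (range b)"
      using assms by (simp only: is_poly_basis_def UNIV_I)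
    moreover have "L x = L' x" if "x \<in> range b" for x
      using L L' that by (elim rangeE) (simp only: is_diagonal_operator_def)
    ultimately show "L p = L' p"
      using L L' real_poly_pair.linear_eq_on[of L L' p "range b"]
      by (simp only: is_diagonal_operator_def)
  qed
qed

text \<open>By \<open>diagonal_operator_unique\<close>, the existential quantifier refers to the unique operator
  determined by \<open>b\<close> and \<open>\<gamma>\<close>.\<close>

definition is_CZDS :: "(nat \<Rightarrow> real poly) \<Rightarrow> (nat \<Rightarrow> real) \<Rightarrow> bool" where
  "is_CZDS b \<gamma> \<longleftrightarrow>
     is_poly_basis b \<and>
     (\<exists>L. is_diagonal_operator b \<gamma> L \<and>
          (\<forall>p. nonreal_zero_count (L p) \<le> nonreal_zero_count p))"

definition gen_laguerre :: "real \<Rightarrow> nat \<Rightarrow> real poly" where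
  "gen_laguerre \<alpha> n =
     (\<Sum>k=0..n. smult (((real n + \<alpha>) gchoose (n - k)) / fact k) ([:0, -1:] ^ k))"

end

theory Submission
  imports Defs "HOL-Computational_Algebra.Fundamental_Theorem_Algebra"
begin

text \<open>
  Put \<open>\<delta>\<^sub>\<alpha> p = (x - \<alpha> - 1) p' - x p''\<close>. Laguerre's differential equation says that
  \<open>\<delta>\<^sub>\<alpha>\<close> has eigenvalue \<open>n\<close> at \<open>L\<^sub>n\<^sup>(\<^sup>\<alpha>\<^sup>)\<close>, so the operator in question is the product of the
  \<open>(\<delta>\<^sub>\<alpha> - k) ^ m\<^sub>k\<close>. Taken alone, a factor with \<open>k > 0\<close> may create non-real zeros: \<open>\<delta>\<^sub>\<alpha> - 1\<close>
  removes the middle term of \<open>L\<^sub>2 + b L\<^sub>1 + c\<close>, which has real zeros for large \<open>b\<close>, and leaves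
  \<open>L\<^sub>2 - c\<close>, which has none if \<open>-c\<close> is large. The point is to rearrange the whole product so
  that only \<open>k = 0\<close> occurs, at shifted values of \<open>\<alpha>\<close>.

  Write \<open>D\<close> for differentiation and \<open>R\<^sub>\<alpha> q = (\<alpha> + 1 - x) q + x q'\<close> (\<open>laguerre_raise\<close>). Then
  \<open>\<delta>\<^sub>\<alpha> = - R\<^sub>\<alpha> D\<close>. The operator \<open>D\<close> sends \<open>L\<^sub>n\<^sup>(\<^sup>\<alpha>\<^sup>)\<close> to \<open>- L\<^sub>n\<^sub>-\<^sub>1\<^sup>(\<^sup>\<alpha>\<^sup>+\<^sup>1\<^sup>)\<close>, and \<open>R\<^sub>\<alpha>\<close> leads back, with the factor
  \<open>n\<close>. Hence \<open>D (\<delta>\<^sub>\<alpha> - k) = (\<delta>\<^sub>\<alpha>\<^sub>+\<^sub>1 - (k - 1)) D\<close>. Since \<open>m\<^sub>0 > 0\<close>, one of the factors \<open>\<delta>\<^sub>\<alpha>\<close> can be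
  split as \<open>- R\<^sub>\<alpha> D\<close>, and \<open>D\<close> is moved to the right through the factors with \<open>k > 0\<close>:
  the product becomes \<open>\<delta>\<^sub>\<alpha> ^ (m\<^sub>0 - 1) (- R\<^sub>\<alpha>) P D\<close>, where \<open>P\<close> is the operator of the same kind
  for \<open>\<alpha> + 1\<close>, with the exponents \<open>m\<^sub>1, m\<^sub>2, \<dots>\<close>. Induction on the number of factors writes the
  operator, up to sign, as a composition of operators \<open>D\<close> and \<open>R\<^sub>\<beta>\<close> with \<open>\<beta> > -1\<close>
  (\<open>ex_zero_decreasing_diagonal_operator\<close>).

  It remains that neither \<open>D\<close> nor \<open>R\<^sub>\<beta>\<close> creates non-real zeros. Their number is the degree
  minus the number of real zeros, both with multiplicity. Differentiation lowers the degree by one, and loses at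
  most one real zero by Rolle's theorem. The operator \<open>R\<^sub>\<beta>\<close> raises the degree by one and
  gains at least one real zero, by Rolle's theorem for \<open>\<bar>x\<bar> powr (\<beta> + 1) * exp (-x) * q\<close>, which has
  the additional zeros \<open>0\<close> and \<open>\<infinity>\<close> (\<open>nonreal_zero_count_laguerre_raise_le\<close>).
\<close>

section \<open>Counting non-real zeros through the real ones\<close>

lemma poly_map_poly_of_real:
  "poly (map_poly complex_of_real p) (of_real x) = of_real (poly p x)"
  by (induction p) (auto simp: map_poly_pCons)

lemma map_poly_of_real_mult:
  "map_poly complex_of_real (p * q) = map_poly of_real p * map_poly of_real q"
  by (rule poly_eqI) (simp add: coeff_map_poly coeff_mult)

lemma map_poly_of_real_power:
  "map_poly complex_of_real (p ^ n) = map_poly of_real p ^ n"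
  by (induction n) (auto simp: map_poly_of_real_mult)

text \<open>Once the linear factors at \<open>x\<close> are split off, the cofactor does not vanish at \<open>x\<close>, and
  its value there is the same over the complex numbers.\<close>

lemma order_map_poly_of_real:
  assumes "p \<noteq> 0"
  shows "order (of_real x) (map_poly complex_of_real p) = order x p"
proof -
  obtain q where q: "p = [:-x, 1:] ^ order x p * q" "\<not> [:-x, 1:] dvd q"
    using order_decomp[OF assms] by blast
  have "map_poly complex_of_real [:-x, 1:] = [:-of_real x, 1:]"
    by (simp add: map_poly_pCons)
  then have eq: "map_poly complex_of_real p
      = [:-of_real x, 1:] ^ order x p * map_poly of_real q"
    using arg_cong[OF q(1), of "map_poly complex_of_real"]
    by (simp add: map_poly_of_real_mult map_poly_of_real_power)
  have nz: "poly (map_poly complex_of_real q) (of_real x) \<noteq> 0"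
    using q(2) by (simp add: poly_map_poly_of_real poly_eq_0_iff_dvd)
  show ?thesis
  proof (rule order_unique_lemma)
    show "[:-complex_of_real x, 1:] ^ order x p dvd map_poly of_real p"
      using eq by simp
    show "\<not> [:-complex_of_real x, 1:] ^ Suc (order x p) dvd map_poly of_real p"
      unfolding eq power_Suc2 using nz by (subst dvd_times_left_cancel_iff) (auto simp: poly_eq_0_iff_dvd)
  qed
qed

text \<open>By the fundamental theorem of algebra the orders of all complex zeros add up to the
  degree. This turns every statement on non-real zeros into one on real zeros.\<close>

lemma nonreal_zero_count_add_real_zeros:
  assumes "p \<noteq> 0"
  shows "nonreal_zero_count p + (\<Sum>x | poly p x = 0. order x p) = degree p"
proof -
  let ?P = "map_poly complex_of_real p"
  have P: "?P \<noteq> 0" using assms by (simp add: map_poly_eq_0_iff)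
  have fin: "finite {z. poly ?P z = 0}" using P by (rule poly_roots_finite)
  have "degree p = degree ?P" by (rule degree_map_poly[symmetric]) simp
  also have "\<dots> = (\<Sum>z | poly ?P z = 0. order z ?P)"
    using P by (simp add: size_proots_complex[symmetric] size_multiset_overloaded_eq)
  also have "{z. poly ?P z = 0} =
      {z. poly ?P z = 0 \<and> z \<notin> \<real>} \<union> {z. poly ?P z = 0 \<and> z \<in> \<real>}" by blast
  also have "(\<Sum>z\<in>\<dots>. order z ?P) =
      nonreal_zero_count p + (\<Sum>z | poly ?P z = 0 \<and> z \<in> \<real>. order z ?P)"
    using assms fin by (subst sum.union_disjoint) (auto simp: nonreal_zero_count_def)
  also have "(\<Sum>z | poly ?P z = 0 \<and> z \<in> \<real>. order z ?P) = (\<Sum>x | poly p x = 0. order x p)"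
  proof -
    have "{z. poly ?P z = 0 \<and> z \<in> \<real>} = of_real ` {x. poly p x = 0}"
      by (auto elim!: Reals_cases simp: poly_map_poly_of_real)
    then show ?thesis
      using assms by (simp add: sum.reindex inj_on_def order_map_poly_of_real)
  qed
  finally show ?thesis by simp
qed

text \<open>This is the bookkeeping of the Rolle arguments below. The zero \<open>t\<close> that belongs to \<open>s\<close>
  precedes the next point of \<open>S\<close>. So different \<open>s\<close> have different \<open>t\<close>, all outside \<open>S\<close>, and
  each adds at least one to the orders found at the points of \<open>S\<close>.\<close>

lemma real_zeros_ge_interlacing:
  fixes Q :: "real poly"
  assumes "Q \<noteq> 0" "finite S"
    and gap: "\<And>s. s \<in> S' \<Longrightarrow> \<exists>t>s. poly Q t = 0 \<and> S \<inter> {s<..t} = {}"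
    and "S' \<subseteq> S"
  shows "card S' + (\<Sum>s\<in>S. order s Q) \<le> (\<Sum>x | poly Q x = 0. order x Q)"
proof -
  let ?T = "{x. poly Q x = 0}"
  have finT: "finite ?T" using assms(1) by (rule poly_roots_finite)
  obtain f where f: "\<And>s. s \<in> S' \<Longrightarrow> f s > s \<and> poly Q (f s) = 0 \<and> S \<inter> {s<..f s} = {}"
    using gap by metis
  have "inj_on f S'"
  proof (rule inj_onI)
    fix s s' assume s: "s \<in> S'" "s' \<in> S'" "f s = f s'"
    show "s = s'"
    proof (rule linorder_cases[of s s'])
      assume "s < s'"
      then have "s' \<in> S \<inter> {s<..f s}" using s f[of s'] assms(4) by auto
      then show ?thesis using f s by blast
    next
      assume "s' < s"
      then have "s \<in> S \<inter> {s'<..f s'}" using s f[of s] assms(4) by auto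
      then show ?thesis using f s by blast
    qed
  qed
  moreover have "f ` S' \<subseteq> ?T - S" using f by force
  ultimately have "card S' \<le> card (?T - S)"
    using finT by (metis card_image card_mono finite_Diff)
  also have "\<dots> = (\<Sum>x\<in>?T - S. 1)" by simp
  also have "\<dots> \<le> (\<Sum>x\<in>?T - S. order x Q)"
    using assms(1) by (intro sum_mono) (auto simp: Suc_le_eq order_root)
  finally have "card S' + (\<Sum>s\<in>S. order s Q) \<le> (\<Sum>x\<in>(?T - S) \<union> S. order x Q)"
    using finT assms(2) by (subst sum.union_disjoint) auto
  also have "\<dots> = (\<Sum>x\<in>?T. order x Q)"
    using finT assms(1,2) by (intro sum.mono_neutral_right) (auto simp: order_0I)
  finally show ?thesis .
qed

lemma ex_next_in_finite:
  fixes S :: "real set"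
  assumes "finite S" "\<exists>u\<in>S. s < u"
  obtains b where "b \<in> S" "s < b" "S \<inter> {s<..<b} = {}"
proof -
  define b where "b = Min (S \<inter> {s<..})"
  have ne: "S \<inter> {s<..} \<noteq> {}" "finite (S \<inter> {s<..})" using assms by auto
  have "b \<in> S \<inter> {s<..}" unfolding b_def by (rule Min_in) (use ne in auto)
  moreover have "b \<le> x" if "x \<in> S" "s < x" for x
    unfolding b_def using that ne by (intro Min_le) auto
  ultimately show ?thesis using that[of b] by force
qed

section \<open>Differentiation\<close>

lemma order_pderiv_ge:
  fixes p :: "real poly"
  assumes "pderiv p \<noteq> 0"
  shows "order x p \<le> Suc (order x (pderiv p))"
proof (cases "order x p = 0")
  case False
  then show ?thesis
    using assms order_pderiv[of p x] by (cases "p = 0") (auto simp: order_root)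
qed simp

text \<open>At each of its \<open>r\<close> distinct real zeros the polynomial loses at most one order, and Rolle's
  theorem supplies \<open>r - 1\<close> new zeros between them. So at most one real zero is lost
  while the degree drops by one.\<close>

lemma nonreal_zero_count_pderiv_le:
  "nonreal_zero_count (pderiv p) \<le> nonreal_zero_count p"
proof (cases "pderiv p = 0")
  case True
  then show ?thesis by (simp add: nonreal_zero_count_def)
next
  case False
  then have p: "p \<noteq> 0" by auto
  have deg: "degree p = Suc (degree (pderiv p))"
    using False by (metis Suc_pred' degree_pderiv gr_zeroI pderiv_eq_0_iff)
  let ?S = "{x. poly p x = 0}"
  have fin: "finite ?S" using p by (rule poly_roots_finite)
  have "(\<Sum>x\<in>?S. order x p) \<le> Suc (\<Sum>x | poly (pderiv p) x = 0. order x (pderiv p))"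
  proof (cases "?S = {}")
    case ne: False
    have "card (?S - {Max ?S}) + (\<Sum>x\<in>?S. order x (pderiv p)) \<le>
        (\<Sum>x | poly (pderiv p) x = 0. order x (pderiv p))"
    proof (rule real_zeros_ge_interlacing[OF False fin])
      fix s assume s: "s \<in> ?S - {Max ?S}"
      then have "\<exists>u\<in>?S. s < u"
        using fin ne Max_in[OF fin ne] by (intro bexI[of _ "Max ?S"]) (auto simp: less_le)
      then obtain b where b: "b \<in> ?S" "s < b" "?S \<inter> {s<..<b} = {}"
        using fin ex_next_in_finite by blast
      obtain t where "s < t" "t < b" "poly p b - poly p s = (b - s) * poly (pderiv p) t"
        using poly_MVT[OF b(2)] by blast
      with s b show "\<exists>t>s. poly (pderiv p) t = 0 \<and> ?S \<inter> {s<..t} = {}"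
        by (intro exI[of _ t]) auto
    qed auto
    moreover have "Suc (card (?S - {Max ?S})) = card ?S"
      using fin Max_in[OF fin ne] by (rule card_Suc_Diff1)
    moreover have "(\<Sum>x\<in>?S. order x p) \<le> (\<Sum>x\<in>?S. Suc (order x (pderiv p)))"
      by (intro sum_mono order_pderiv_ge False)
    moreover have "\<dots> = card ?S + (\<Sum>x\<in>?S. order x (pderiv p))"
      by (simp only: sum_Suc add.commute)
    ultimately show ?thesis by linarith
  qed simp
  then show ?thesis
    using nonreal_zero_count_add_real_zeros[OF p] nonreal_zero_count_add_real_zeros[OF False] deg
    by linarith
qed

section \<open>The raising operator\<close>

text \<open>For \<open>x > 0\<close> this is \<open>x powr (-\<alpha>) * exp x * (x powr (\<alpha> + 1) * exp (-x) * q)'\<close>, the building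
  block of Rodrigues' formula.\<close>

definition laguerre_raise :: "real \<Rightarrow> real poly \<Rightarrow> real poly" where
  "laguerre_raise \<alpha> q = [:\<alpha> + 1, -1:] * q + [:0, 1:] * pderiv q"

lemma poly_laguerre_raise:
  "poly (laguerre_raise \<alpha> q) x = (\<alpha> + 1 - x) * poly q x + x * poly (pderiv q) x"
  by (simp add: laguerre_raise_def algebra_simps)

lemma coeff_laguerre_raise_0: "coeff (laguerre_raise \<alpha> q) 0 = (\<alpha> + 1) * coeff q 0"
  by (simp add: laguerre_raise_def)

lemma coeff_laguerre_raise_Suc:
  "coeff (laguerre_raise \<alpha> q) (Suc k) = (\<alpha> + 1 + real (Suc k)) * coeff q (Suc k) - coeff q k"
  by (simp add: laguerre_raise_def coeff_pderiv algebra_simps)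

lemma degree_laguerre_raise:
  assumes "q \<noteq> 0"
  shows "degree (laguerre_raise \<alpha> q) = Suc (degree q)"
proof (rule antisym)
  show "degree (laguerre_raise \<alpha> q) \<le> Suc (degree q)"
  proof (rule degree_le, intro allI impI)
    fix i assume "i > Suc (degree q)"
    then show "coeff (laguerre_raise \<alpha> q) i = 0"
      by (cases i) (auto simp: coeff_laguerre_raise_Suc coeff_eq_0)
  qed
  show "Suc (degree q) \<le> degree (laguerre_raise \<alpha> q)"
    using assms by (intro le_degree) (simp add: coeff_laguerre_raise_Suc coeff_eq_0)
qed

lemma laguerre_raise_eq_0_iff [simp]: "laguerre_raise \<alpha> q = 0 \<longleftrightarrow> q = 0"
proof
  show "laguerre_raise \<alpha> q = 0 \<Longrightarrow> q = 0"
    using degree_laguerre_raise[of q \<alpha>] by (cases "q = 0") auto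
qed (simp add: laguerre_raise_def)

lemma lead_coeff_laguerre_raise: "lead_coeff (laguerre_raise \<alpha> q) = - lead_coeff q"
  by (cases "q = 0") (auto simp: degree_laguerre_raise coeff_laguerre_raise_Suc coeff_eq_0)

text \<open>The power of \<open>x\<^sup>2\<close> is \<open>\<bar>x\<bar> powr (\<alpha> + 1)\<close>, in a form that is differentiated by the same
  formula on both half-lines.\<close>

definition laguerre_weighted :: "real \<Rightarrow> real poly \<Rightarrow> real \<Rightarrow> real" where
  "laguerre_weighted \<alpha> q x = (x\<^sup>2) powr ((\<alpha> + 1) / 2) * exp (-x) * poly q x"

lemma DERIV_laguerre_weighted:
  assumes "x \<noteq> 0"
  shows "(laguerre_weighted \<alpha> q has_real_derivative
    x * (x\<^sup>2) powr ((\<alpha> + 1) / 2 - 1) * exp (-x) * poly (laguerre_raise \<alpha> q) x) (at x)"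
proof -
  have x2: "x\<^sup>2 > 0" using assms by simp
  define c where "c = (\<alpha> + 1) / 2"
  have \<alpha>: "\<alpha> = 2 * c - 1" by (simp add: c_def field_simps)
  have *: "(x\<^sup>2) powr c = (x\<^sup>2) powr (c - 1) * x\<^sup>2"
    using x2 powr_add[of "x\<^sup>2" "c - 1" 1] by simp
  have "((\<lambda>x. x\<^sup>2) has_real_derivative 2 * x) (at x)"
    by (auto intro!: derivative_eq_intros)
  note D1 = DERIV_fun_powr[OF this x2, of c]
  have D2: "((\<lambda>x. exp (-x)) has_real_derivative - exp (-x)) (at x)"
    by (auto intro!: derivative_eq_intros)
  note D = DERIV_mult[OF DERIV_mult[OF D1 D2] poly_DERIV[of q]]
  show ?thesis
    unfolding laguerre_weighted_def[abs_def] c_def[symmetric]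
    by (rule DERIV_cong[OF D])
      (simp add: * poly_laguerre_raise \<alpha>, simp add: power2_eq_square algebra_simps)
qed

lemma laguerre_weighted_MVT:
  assumes "\<alpha> > -1" "a < b" "0 \<notin> {a<..<b}"
  obtains t where "a < t" "t < b"
    "laguerre_weighted \<alpha> q b - laguerre_weighted \<alpha> q a =
      (b - a) * (t * (t\<^sup>2) powr ((\<alpha> + 1) / 2 - 1) * exp (-t) * poly (laguerre_raise \<alpha> q) t)"
proof -
  have "continuous_on {a..b} (laguerre_weighted \<alpha> q)"
    unfolding laguerre_weighted_def[abs_def]
    using assms(1) by (intro continuous_intros continuous_on_powr') auto
  moreover have "laguerre_weighted \<alpha> q differentiable (at x)" if "a < x" "x < b" for x
    using DERIV_laguerre_weighted[of x \<alpha> q] that assms(3)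
    by (auto simp: real_differentiable_def)
  ultimately obtain l t where t: "a < t" "t < b" "DERIV (laguerre_weighted \<alpha> q) t :> l"
    "laguerre_weighted \<alpha> q b - laguerre_weighted \<alpha> q a = (b - a) * l"
    using MVT[OF assms(2)] by blast
  have "t \<noteq> 0" using t assms(3) by auto
  then show ?thesis using that[of t] t DERIV_unique DERIV_laguerre_weighted by metis
qed

text \<open>The weight vanishes at \<open>0\<close> because \<open>\<alpha> + 1 > 0\<close>, so \<open>0\<close> serves as an end point for Rolle's
  theorem even if \<open>q\<close> does not vanish there.\<close>

lemma laguerre_raise_zero_between:
  assumes "\<alpha> > -1" "a < b" "0 \<notin> {a<..<b}" "a = 0 \<or> poly q a = 0" "b = 0 \<or> poly q b = 0"
  obtains t where "a < t" "t < b" "poly (laguerre_raise \<alpha> q) t = 0"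
proof -
  obtain t where t: "a < t" "t < b"
    "laguerre_weighted \<alpha> q b - laguerre_weighted \<alpha> q a =
      (b - a) * (t * (t\<^sup>2) powr ((\<alpha> + 1) / 2 - 1) * exp (-t) * poly (laguerre_raise \<alpha> q) t)"
    using laguerre_weighted_MVT[OF assms(1-3)] by blast
  moreover have "laguerre_weighted \<alpha> q a = 0" "laguerre_weighted \<alpha> q b = 0"
    using assms(4,5) by (auto simp: laguerre_weighted_def)
  moreover have "t \<noteq> 0" using t assms(3) by auto
  ultimately have "poly (laguerre_raise \<alpha> q) t = 0" using assms(2) by auto
  then show ?thesis using that t by blast
qed

lemma eventually_poly_pos:
  fixes p :: "real poly"
  assumes "lead_coeff p > 0"
  obtains M where "M > x" "poly p M > 0"
proof -
  obtain n where n: "\<And>y. y \<ge> n \<Longrightarrow> poly p y \<ge> lead_coeff p"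
    using poly_pinfty_gt_lc[OF assms] by blast
  show ?thesis using that[of "max n (x + 1)"] n[of "max n (x + 1)"] assms by linarith
qed

text \<open>Rolle's theorem on \<open>(s, \<infinity>)\<close>: the weighted function leaves \<open>0\<close> with the sign of
  \<open>lead_coeff q\<close>, while the raised polynomial, which has the sign of its derivative, finally has the
  opposite sign.\<close>

lemma laguerre_raise_zero_beyond:
  assumes "\<alpha> > -1" "s \<ge> 0" "s = 0 \<or> poly q s = 0" "q \<noteq> 0"
    and nz: "\<And>x. x > s \<Longrightarrow> poly q x \<noteq> 0"
  obtains t where "t > s" "poly (laguerre_raise \<alpha> q) t = 0"
proof -
  have pos: "\<exists>t>s. poly (laguerre_raise \<alpha> q) t = 0"
    if q: "lead_coeff q > 0" "s = 0 \<or> poly q s = 0" "\<And>x. x > s \<Longrightarrow> poly q x \<noteq> 0" for q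
  proof -
    obtain M where M: "M > s + 1" "poly q M > 0" using eventually_poly_pos[OF q(1)] .
    have "poly q (s + 1) > 0"
    proof (rule ccontr)
      assume "\<not> poly q (s + 1) > 0"
      with q(3)[of "s + 1"] have "poly q (s + 1) < 0" by force
      then obtain x where "x > s + 1" "poly q x = 0"
        using poly_IVT_pos[OF M(1) _ M(2)] by blast
      then show False using q(3)[of x] by simp
    qed
    then have F: "laguerre_weighted \<alpha> q (s + 1) > 0"
      using assms(2) by (simp add: laguerre_weighted_def)
    have "laguerre_weighted \<alpha> q s = 0" using q(2) by (auto simp: laguerre_weighted_def)
    moreover obtain t where t: "s < t" "t < s + 1"
      "laguerre_weighted \<alpha> q (s + 1) - laguerre_weighted \<alpha> q s = (s + 1 - s) *
        (t * (t\<^sup>2) powr ((\<alpha> + 1) / 2 - 1) * exp (-t) * poly (laguerre_raise \<alpha> q) t)"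
      using laguerre_weighted_MVT[OF assms(1), of s "s + 1" q] assms(2) by auto
    ultimately have "0 < t * (t\<^sup>2) powr ((\<alpha> + 1) / 2 - 1) * exp (-t) * poly (laguerre_raise \<alpha> q) t"
      using F by simp
    moreover have "0 < t * (t\<^sup>2) powr ((\<alpha> + 1) / 2 - 1) * exp (-t)"
      using t assms(2) by simp
    ultimately have tpos: "poly (laguerre_raise \<alpha> q) t > 0"
      by (simp only: zero_less_mult_pos)
    have "lead_coeff (- laguerre_raise \<alpha> q) > 0"
      using q(1) lead_coeff_laguerre_raise[of \<alpha> q] by simp
    then obtain N where N: "N > t" "poly (- laguerre_raise \<alpha> q) N > 0"
      using eventually_poly_pos by blast
    then obtain x where "x > t" "poly (laguerre_raise \<alpha> q) x = 0"
      using poly_IVT_neg[OF N(1) tpos] by auto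
    then show ?thesis using t(1) by (intro exI[of _ x]) simp
  qed
  have "\<exists>t>s. poly (laguerre_raise \<alpha> q) t = 0"
  proof (cases "lead_coeff q > 0")
    case True
    then show ?thesis using pos assms by blast
  next
    case False
    then have "lead_coeff (- q) > 0" using assms(4) by (simp add: less_le)
    moreover have "laguerre_raise \<alpha> (- q) = - laguerre_raise \<alpha> q"
      by (simp add: laguerre_raise_def pderiv_minus)
    ultimately show ?thesis using pos[of "- q"] assms by auto
  qed
  then show ?thesis using that by blast
qed

text \<open>Differentiation costs one order, but in \<open>(\<alpha> + 1 - x) q + x q'\<close> the factor \<open>x\<close> restores it
  at \<open>0\<close>.\<close>

lemma order_laguerre_raise_ge:
  assumes "q \<noteq> 0"
  shows "order x q \<le> order x (laguerre_raise \<alpha> q) + (if x = 0 then 0 else 1)"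
proof -
  let ?n = "order x q"
  have n: "[:-x, 1:] ^ ?n dvd q" by (rule order_1)
  have n1: "[:-x, 1:] ^ (?n - 1) dvd q"
    using n by (rule power_le_dvd) simp
  have d1: "[:-x, 1:] ^ (?n - 1) dvd pderiv q"
  proof (cases "pderiv q = 0 \<or> ?n = 0")
    case False
    then have "?n - 1 = order x (pderiv q)"
      using assms order_pderiv[of q x] by (auto simp: order_root)
    then show ?thesis using order_1 by metis
  qed auto
  show ?thesis
  proof (cases "x = 0")
    case True
    have "[:-x, 1:] ^ ?n dvd [:0, 1:] * pderiv q"
    proof (cases "?n = 0")
      case False
      then have "[:-x, 1:] ^ ?n = [:0, 1:] * [:-x, 1:] ^ (?n - 1)"
        using True by (cases ?n) auto
      then show ?thesis using d1 by (simp only: mult_dvd_mono dvd_refl)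
    qed simp
    then have "[:-x, 1:] ^ ?n dvd laguerre_raise \<alpha> q"
      unfolding laguerre_raise_def by (rule dvd_add[OF dvd_mult[OF n]])
    then have "?n \<le> order x (laguerre_raise \<alpha> q)"
      using assms order_divides laguerre_raise_eq_0_iff by blast
    then show ?thesis by simp
  next
    case False
    have "[:-x, 1:] ^ (?n - 1) dvd laguerre_raise \<alpha> q"
      unfolding laguerre_raise_def using n1 d1 by (intro dvd_add dvd_mult)
    then show ?thesis using assms False by (auto simp: order_divides)
  qed
qed

text \<open>Let \<open>S\<close> consist of \<open>0\<close> and the real zeros of \<open>q\<close>. Each point of \<open>S\<close>, even the last one, is
  followed by a new zero, and each one except \<open>0\<close> loses at most one order. So the number
  of real zeros grows by at least one, and the degree by exactly one.\<close>

lemma nonreal_zero_count_laguerre_raise_le: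
  assumes "\<alpha> > -1"
  shows "nonreal_zero_count (laguerre_raise \<alpha> q) \<le> nonreal_zero_count q"
proof (cases "q = 0")
  case False
  let ?R = "laguerre_raise \<alpha> q"
  have R: "?R \<noteq> 0" using False by simp
  define S where "S = insert 0 {x. poly q x = 0}"
  have fin: "finite S" using poly_roots_finite[OF False] by (simp add: S_def)
  have "card S + (\<Sum>x\<in>S. order x ?R) \<le> (\<Sum>x | poly ?R x = 0. order x ?R)"
  proof (rule real_zeros_ge_interlacing[OF R fin])
    fix s assume s: "s \<in> S"
    show "\<exists>t>s. poly ?R t = 0 \<and> S \<inter> {s<..t} = {}"
    proof (cases "\<exists>u\<in>S. s < u")
      case True
      then obtain b where b: "b \<in> S" "s < b" "S \<inter> {s<..<b} = {}"
        using fin ex_next_in_finite by blast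
      moreover have "0 \<notin> {s<..<b}" using b(3) by (auto simp: S_def)
      ultimately obtain t where t: "s < t" "t < b" "poly ?R t = 0"
        using laguerre_raise_zero_between[OF assms, of s b q] s by (auto simp: S_def)
      then have "{s<..t} \<subseteq> {s<..<b}" by auto
      with t b(3) show ?thesis by blast
    next
      case last: False
      have "s \<ge> 0" using last by (auto simp: S_def)
      moreover have "s = 0 \<or> poly q s = 0" using s by (auto simp: S_def)
      moreover have "poly q x \<noteq> 0" if "x > s" for x using last that by (auto simp: S_def)
      ultimately obtain t where t: "t > s" "poly ?R t = 0"
        using laguerre_raise_zero_beyond[OF assms _ _ False] by blast
      then show ?thesis using last by (intro exI[of _ t]) auto
    qed
  qed simp
  moreover have "(\<Sum>x | poly q x = 0. order x q) = (\<Sum>x\<in>S. order x q)"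
    using fin by (intro sum.mono_neutral_left) (auto simp: S_def order_0I)
  moreover have "(\<Sum>x\<in>S. order x q) \<le> (\<Sum>x\<in>S. order x ?R + (if x = 0 then 0 else 1))"
    by (intro sum_mono order_laguerre_raise_ge False)
  moreover have "Suc (\<Sum>x\<in>S. order x ?R + (if x = 0 then 0 else 1))
      = card S + (\<Sum>x\<in>S. order x ?R)"
  proof -
    have "0 \<in> S" by (simp add: S_def)
    have "Suc (\<Sum>x\<in>S. if x = 0 then 0 else 1) = Suc (card (S - {0}))"
      using fin \<open>0 \<in> S\<close> by (simp add: sum.remove)
    also have "\<dots> = card S" using fin \<open>0 \<in> S\<close> by (rule card_Suc_Diff1)
    finally show ?thesis by (simp add: sum.distrib)
  qed
  ultimately have "Suc (\<Sum>x | poly q x = 0. order x q) \<le> (\<Sum>x | poly ?R x = 0. order x ?R)"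
    by linarith
  then show ?thesis
    using nonreal_zero_count_add_real_zeros[OF False] nonreal_zero_count_add_real_zeros[OF R]
      degree_laguerre_raise[OF False, of \<alpha>]
    by linarith
next
  case True
  then show ?thesis by (simp add: laguerre_raise_def)
qed

section \<open>Ladder relations and the basis property\<close>

lemma coeff_gen_laguerre:
  "coeff (gen_laguerre \<alpha> n) k =
    (if k \<le> n then (-1) ^ k * ((real n + \<alpha>) gchoose (n - k)) / fact k else 0)"
proof -
  have "[:0, -1 :: real:] = monom (-1) 1" by (simp add: monom_Suc monom_0)
  then have "coeff ([:0, -1 :: real:] ^ i) k = (if i = k then (-1) ^ i else 0)" for i
    by (simp add: monom_power)
  then show ?thesis
    by (auto simp: gen_laguerre_def coeff_sum if_distrib[of "\<lambda>x. _ * x"] sum.delta cong: if_cong)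
qed

lemma degree_gen_laguerre: "degree (gen_laguerre \<alpha> n) = n"
  by (rule antisym; (rule degree_le | rule le_degree)) (auto simp: coeff_gen_laguerre)

lemma pderiv_gen_laguerre_0: "pderiv (gen_laguerre \<alpha> 0) = 0"
  by (simp add: pderiv_eq_0_iff degree_gen_laguerre)

lemma pderiv_gen_laguerre_Suc:
  "pderiv (gen_laguerre \<alpha> (Suc n)) = - gen_laguerre (\<alpha> + 1) n"
proof (rule poly_eqI)
  fix k
  have "real (Suc k) * (x / fact (Suc k)) = x / fact k" for x
    by simp
  moreover have "real (Suc n) + \<alpha> = real n + (\<alpha> + 1)" by simp
  ultimately show "coeff (pderiv (gen_laguerre \<alpha> (Suc n))) k = coeff (- gen_laguerre (\<alpha> + 1) n) k"
    by (simp only: coeff_pderiv coeff_gen_laguerre coeff_minus) simp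
qed

text \<open>Comparing coefficients, this is the absorption identity
  \<open>(j + 1) (a gchoose (j + 1)) = (a - j) (a gchoose j)\<close> for \<open>a = n + 1 + \<alpha>\<close>.\<close>

lemma laguerre_raise_gen_laguerre:
  "laguerre_raise \<alpha> (gen_laguerre (\<alpha> + 1) n) = smult (real (Suc n)) (gen_laguerre \<alpha> (Suc n))"
proof (rule poly_eqI)
  fix k
  define a where "a = real n + 1 + \<alpha>"
  have absorb: "real (Suc j) * (a gchoose Suc j) = (a - real j) * (a gchoose j)" for j
    using gbinomial_mult_1[of a j] by (simp add: algebra_simps)
  have a: "real n + (\<alpha> + 1) = a" "real (Suc n) + \<alpha> = a" by (auto simp: a_def)
  note c = coeff_gen_laguerre a
  show "coeff (laguerre_raise \<alpha> (gen_laguerre (\<alpha> + 1) n)) k =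
      coeff (smult (real (Suc n)) (gen_laguerre \<alpha> (Suc n))) k"
  proof (cases k)
    case 0
    then show ?thesis
      using absorb[of n] by (simp add: coeff_laguerre_raise_0 coeff_gen_laguerre a_def add_ac)
  next
    case (Suc i)
    consider "i < n" | "i = n" | "i > n" by linarith
    then show ?thesis
    proof cases
      case 1
      define j where "j = n - Suc i"
      have j: "n - i = Suc j" "real n = real i + 1 + real j" using 1 by (auto simp: j_def)
      have rec: "(\<alpha> + 1 + real (Suc i)) * (a gchoose j) + real (Suc i) * (a gchoose Suc j)
          = real (Suc n) * (a gchoose Suc j)"
        using absorb[of j] j(2) by (simp add: a_def algebra_simps)
      have f: "y / fact i = real (Suc i) * y / fact (Suc i)" for y :: real
        by simp
      have "(\<alpha> + 1 + real (Suc i)) * ((-1) ^ Suc i * (a gchoose j) / fact (Suc i))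
          - (-1) ^ i * (a gchoose Suc j) / fact i
          = (-1) ^ Suc i / fact (Suc i) *
            ((\<alpha> + 1 + real (Suc i)) * (a gchoose j) + real (Suc i) * (a gchoose Suc j))"
        unfolding f[of "(-1) ^ i * (a gchoose Suc j)"]
        by (simp add: algebra_simps add_divide_distrib diff_divide_distrib
            del: fact_Suc of_nat_Suc)
      also have "\<dots> = real (Suc n) * ((-1) ^ Suc i * (a gchoose Suc j) / fact (Suc i))"
        unfolding rec by simp
      finally have "(\<alpha> + 1 + real (Suc i)) * ((-1) ^ Suc i * (a gchoose j) / fact (Suc i))
          - (-1) ^ i * (a gchoose Suc j) / fact i
          = real (Suc n) * ((-1) ^ Suc i * (a gchoose Suc j) / fact (Suc i))" .
      then show ?thesis
        using 1 Suc j(1) j_def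
        by (simp add: coeff_laguerre_raise_Suc c del: of_nat_Suc fact_Suc)
    qed (use Suc in \<open>auto simp: coeff_laguerre_raise_Suc c divide_simps\<close>)
  qed
qed

text \<open>In a vanishing linear combination, the term of largest degree could not be cancelled;
  and every polynomial is reduced to lower degree by subtracting a multiple of some \<open>b n\<close>.\<close>

lemma is_poly_basis_if_degree_eq:
  assumes deg: "\<And>n. degree (b n) = n" and nz: "\<And>n. b n \<noteq> 0"
  shows "is_poly_basis b"
proof -
  have inj: "inj b" using deg by (metis injI)
  have "\<not> real_poly.dependent (range b)"
  proof
    assume "real_poly.dependent (range b)"
    then obtain t u v where t: "finite t" "t \<subseteq> range b" "(\<Sum>v\<in>t. smult (u v) v) = 0"
      and v: "v \<in> t" "u v \<noteq> 0"
      unfolding real_poly.dependent_explicit by blast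
    define T where "T = {v \<in> t. u v \<noteq> 0}"
    have T: "finite T" "T \<noteq> {}" using t v by (auto simp: T_def)
    have "Max (degree ` T) \<in> degree ` T" using T by (intro Max_in) auto
    then obtain m where "m \<in> T" "degree m = Max (degree ` T)" by (auto dest: sym)
    then have m: "m \<in> T" "\<And>x. x \<in> T \<Longrightarrow> degree x \<le> degree m"
      using T(1) by auto
    have less: "degree x < degree m" if "x \<in> T" "x \<noteq> m" for x
    proof -
      have "x \<in> range b" "m \<in> range b" using that(1) m(1) t(2) by (auto simp: T_def)
      then obtain i j where "x = b i" "m = b j" by blast
      then have "degree x \<noteq> degree m" using that(2) deg by auto
      then show ?thesis using m(2)[OF that(1)] by simp
    qed
    have "(\<Sum>v\<in>T. smult (u v) v) = (\<Sum>v\<in>t. smult (u v) v)"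
      using t(1) by (intro sum.mono_neutral_left) (auto simp: T_def)
    then have "0 = coeff (\<Sum>v\<in>T. smult (u v) v) (degree m)" using t(3) by simp
    also have "\<dots> = (\<Sum>v\<in>T. u v * coeff v (degree m))" by (simp add: coeff_sum)
    also have "\<dots> = (\<Sum>v\<in>{m}. u v * coeff v (degree m))"
      using T m less by (intro sum.mono_neutral_right) (auto simp: coeff_eq_0)
    finally show False using m(1) t(2) nz by (auto simp: T_def)
  qed
  moreover have "p \<in> real_poly.span (range b)" for p
  proof (induction "degree p" arbitrary: p rule: less_induct)
    case less
    define n where "n = degree p"
    define c where "c = lead_coeff p / lead_coeff (b n)"
    define q where "q = p - smult c (b n)"
    have cb: "smult c (b n) \<in> real_poly.span (range b)"
      by (intro real_poly.span_scale real_poly.span_base) simp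
    have q0: "coeff q i = 0" if "i \<ge> n" for i
    proof (cases "i = n")
      case True
      moreover have "coeff (b n) n \<noteq> 0" using nz[of n] deg[of n] leading_coeff_neq_0 by metis
      ultimately show ?thesis using deg[of n] by (simp add: q_def c_def n_def)
    next
      case False
      then show ?thesis using that deg[of n] by (auto simp: q_def n_def coeff_eq_0)
    qed
    have "q \<in> real_poly.span (range b)"
    proof (cases "q = 0")
      case False
      then have "degree q < n" using q0 by (metis leading_coeff_0_iff not_le)
      then show ?thesis using less n_def by blast
    qed (simp add: real_poly.span_zero)
    then have "q + smult c (b n) \<in> real_poly.span (range b)" using cb by (rule real_poly.span_add)
    then show ?case by (simp add: q_def)
  qed
  ultimately show ?thesis using inj by (auto simp: is_poly_basis_def)
qed

lemma is_poly_basis_gen_laguerre: "is_poly_basis (gen_laguerre \<alpha>)"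
proof (rule is_poly_basis_if_degree_eq)
  fix n
  have "coeff (gen_laguerre \<alpha> n) n \<noteq> 0" by (simp add: coeff_gen_laguerre)
  then show "gen_laguerre \<alpha> n \<noteq> 0" by auto
qed (rule degree_gen_laguerre)

section \<open>The diagonal operator\<close>

lemma nonreal_zero_count_uminus [simp]: "nonreal_zero_count (- p) = nonreal_zero_count p"
proof -
  have "map_poly complex_of_real (- p) = - map_poly of_real p"
    by (rule poly_eqI) (simp add: coeff_map_poly)
  then show ?thesis by (simp add: nonreal_zero_count_def)
qed

lemma linear_laguerre_raise: "Vector_Spaces.linear smult smult (laguerre_raise \<alpha>)"
  by unfold_locales
    (simp_all add: laguerre_raise_def pderiv_add pderiv_smult algebra_simps smult_add_right)

lemma linear_pderiv: "Vector_Spaces.linear smult smult (pderiv :: real poly \<Rightarrow> real poly)"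
  by unfold_locales (simp_all add: pderiv_add pderiv_smult)

lemma linear_uminus_poly: "Vector_Spaces.linear smult smult (uminus :: real poly \<Rightarrow> real poly)"
  by unfold_locales simp_all

text \<open>Expanded, this is \<open>(x - \<alpha> - 1) p' - x p''\<close>, the operator of Laguerre's differential
  equation.\<close>

definition laguerre_operator :: "real \<Rightarrow> real poly \<Rightarrow> real poly" where
  "laguerre_operator \<alpha> p = - laguerre_raise \<alpha> (pderiv p)"

lemma linear_laguerre_operator: "Vector_Spaces.linear smult smult (laguerre_operator \<alpha>)"
  using Vector_Spaces.linear_compose[OF linear_pderiv
      Vector_Spaces.linear_compose[OF linear_laguerre_raise linear_uminus_poly]]
  by (simp add: laguerre_operator_def[abs_def] o_def)

lemma laguerre_operator_gen_laguerre:
  "laguerre_operator \<alpha> (gen_laguerre \<alpha> n) = smult (real n) (gen_laguerre \<alpha> n)"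
proof (cases n)
  case 0
  then show ?thesis by (simp add: laguerre_operator_def pderiv_gen_laguerre_0)
next
  case (Suc k)
  have "laguerre_raise \<alpha> (- p) = - laguerre_raise \<alpha> p" for p
    by (simp add: laguerre_raise_def pderiv_minus)
  then show ?thesis
    unfolding Suc by (simp only: laguerre_operator_def pderiv_gen_laguerre_Suc
        laguerre_raise_gen_laguerre minus_minus)
qed

lemma nonreal_zero_count_laguerre_operator_le:
  assumes "\<alpha> > -1"
  shows "nonreal_zero_count (laguerre_operator \<alpha> p) \<le> nonreal_zero_count p"
  unfolding laguerre_operator_def nonreal_zero_count_uminus
  by (rule order_trans[OF nonreal_zero_count_laguerre_raise_le[OF assms]
        nonreal_zero_count_pderiv_le])

lemma is_diagonal_operator_compose_power:
  assumes "is_diagonal_operator b \<gamma> D" "is_diagonal_operator b \<mu> L"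
  shows "is_diagonal_operator b (\<lambda>n. \<gamma> n ^ j * \<mu> n) (\<lambda>p. (D ^^ j) (L p))"
proof (induction j)
  case 0
  then show ?case using assms(2) by simp
next
  case (Suc j)
  then have lin: "Vector_Spaces.linear smult smult (\<lambda>p. (D ^^ j) (L p))"
    and D: "Vector_Spaces.linear smult smult D"
    using assms by (auto simp: is_diagonal_operator_def)
  then interpret D: Vector_Spaces.linear smult smult D by simp
  show ?case
    using Suc assms Vector_Spaces.linear_compose[OF lin D]
    by (simp add: is_diagonal_operator_def o_def D.scale mult_ac)
qed

text \<open>Differentiation leads from \<open>\<alpha>\<close> and \<open>n\<close> to \<open>\<alpha> + 1\<close> and \<open>n - 1\<close>, and the raising operator leads
  back. At \<open>n = 0\<close>, where \<open>n - 1\<close> is truncated, differentiation kills the constant, in agreement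
  with the factor \<open>real n\<close>.\<close>

lemma diagonal_operator_shift:
  assumes "is_diagonal_operator (gen_laguerre (\<alpha> + 1)) \<mu> L"
  shows "is_diagonal_operator (gen_laguerre \<alpha>) (\<lambda>n. real n * \<mu> (n - 1))
    (\<lambda>p. - laguerre_raise \<alpha> (L (pderiv p)))"
proof -
  have L: "Vector_Spaces.linear smult smult L"
    and eig: "L (gen_laguerre (\<alpha> + 1) n) = smult (\<mu> n) (gen_laguerre (\<alpha> + 1) n)" for n
    using assms by (auto simp: is_diagonal_operator_def)
  interpret L: Vector_Spaces.linear smult smult L by (rule L)
  interpret R: Vector_Spaces.linear smult smult "laguerre_raise \<alpha>" by (rule linear_laguerre_raise)
  have "- laguerre_raise \<alpha> (L (pderiv (gen_laguerre \<alpha> n))) =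
      smult (real n * \<mu> (n - 1)) (gen_laguerre \<alpha> n)" for n
  proof (cases n)
    case 0
    then show ?thesis by (simp add: pderiv_gen_laguerre_0 L.zero R.zero)
  next
    case (Suc k)
    then show ?thesis
      by (simp add: pderiv_gen_laguerre_Suc L.neg R.neg eig R.scale laguerre_raise_gen_laguerre
          mult.commute del: of_nat_Suc)
  qed
  then show ?thesis
    using Vector_Spaces.linear_compose[OF linear_pderiv Vector_Spaces.linear_compose[OF L
      Vector_Spaces.linear_compose[OF linear_laguerre_raise linear_uminus_poly]]]
    by (simp add: is_diagonal_operator_def o_def)
qed

text \<open>With \<open>k\<close> replaced by \<open>k + 1\<close>, the factor \<open>n - k\<close> becomes \<open>(n - 1) - k\<close>. So the factors with
  \<open>k > 0\<close> form the sequence of the induction hypothesis for \<open>\<alpha> + 1\<close>, shifted by one in \<open>n\<close>.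
  \<open>diagonal_operator_shift\<close> undoes the shift at the price of one factor \<open>n\<close>, which is
  where \<open>m 0 > 0\<close> enters; the other \<open>m 0 - 1\<close> factors \<open>n\<close> are supplied by powers of
  \<open>laguerre_operator\<close>.\<close>

lemma ex_zero_decreasing_diagonal_operator:
  assumes "\<alpha> > -1" "\<forall>k<w. m k > 0"
  shows "\<exists>L. is_diagonal_operator (gen_laguerre \<alpha>) (\<lambda>n. \<Prod>k<w. (real n - real k) ^ m k) L \<and>
    (\<forall>p. nonreal_zero_count (L p) \<le> nonreal_zero_count p)"
  using assms
proof (induction w arbitrary: \<alpha> m)
  case 0
  have "Vector_Spaces.linear smult smult (\<lambda>p :: real poly. p)"
    by unfold_locales simp_all
  then show ?case by (intro exI[of _ "\<lambda>p. p"]) (simp add: is_diagonal_operator_def)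
next
  case (Suc w)
  have "\<alpha> + 1 > -1" "\<forall>k<w. m (Suc k) > 0" using Suc.prems by auto
  from Suc.IH[OF this] obtain L where
    L: "is_diagonal_operator (gen_laguerre (\<alpha> + 1)) (\<lambda>n. \<Prod>k<w. (real n - real k) ^ m (Suc k)) L"
    and dec: "\<And>p. nonreal_zero_count (L p) \<le> nonreal_zero_count p" by blast
  define K where "K = (\<lambda>p. - laguerre_raise \<alpha> (L (pderiv p)))"
  define j where "j = m 0 - 1"
  have m0: "m 0 = Suc j" using Suc.prems(2) by (simp add: j_def)
  define M where "M = (\<lambda>p. (laguerre_operator \<alpha> ^^ j) (K p))"
  have "is_diagonal_operator (gen_laguerre \<alpha>) real (laguerre_operator \<alpha>)"
    by (simp add: is_diagonal_operator_def linear_laguerre_operator laguerre_operator_gen_laguerre)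
  from is_diagonal_operator_compose_power[OF this diagonal_operator_shift[OF L], of j]
  have "is_diagonal_operator (gen_laguerre \<alpha>)
      (\<lambda>n. real n ^ j * (real n * (\<Prod>k<w. (real (n - 1) - real k) ^ m (Suc k)))) M"
    by (simp add: M_def K_def)
  moreover have "(\<lambda>n. real n ^ j * (real n * (\<Prod>k<w. (real (n - 1) - real k) ^ m (Suc k)))) =
      (\<lambda>n. \<Prod>k<Suc w. (real n - real k) ^ m k)"
  proof
    fix n
    show "real n ^ j * (real n * (\<Prod>k<w. (real (n - 1) - real k) ^ m (Suc k))) =
        (\<Prod>k<Suc w. (real n - real k) ^ m k)"
      by (cases n) (simp_all add: prod.lessThan_Suc_shift m0 del: prod.lessThan_Suc)
  qed
  moreover have "nonreal_zero_count (M p) \<le> nonreal_zero_count p" for p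
  proof -
    have "nonreal_zero_count (K p) \<le> nonreal_zero_count (L (pderiv p))"
      unfolding K_def nonreal_zero_count_uminus
      by (rule nonreal_zero_count_laguerre_raise_le[OF Suc.prems(1)])
    also have "\<dots> \<le> nonreal_zero_count p"
      by (rule order_trans[OF dec nonreal_zero_count_pderiv_le])
    finally have "nonreal_zero_count (K p) \<le> nonreal_zero_count p" .
    moreover have "nonreal_zero_count ((laguerre_operator \<alpha> ^^ i) q) \<le> nonreal_zero_count q" for i q
      by (induction i)
        (auto intro: order_trans[OF nonreal_zero_count_laguerre_operator_le[OF Suc.prems(1)]])
    ultimately show ?thesis unfolding M_def using order_trans by blast
  qed
  ultimately show ?case by (intro exI[of _ M]) simp
qed

theorem theorem23:
  fixes \<alpha> :: real and w :: nat and m :: "nat \<Rightarrow> nat"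
  assumes "\<alpha> > -1"
    and "w > 0"
    and "\<And>k. k < w \<Longrightarrow> m k > 0"
  shows "is_CZDS (gen_laguerre \<alpha>) (\<lambda>n. \<Prod>k<w. (real n - real k) ^ m k)"
  unfolding is_CZDS_def
  using is_poly_basis_gen_laguerre ex_zero_decreasing_diagonal_operator[OF assms(1)] assms(3)
  by blast

end
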